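(* Let $\alpha>0$. Then, uniformly on compact subsets of $[0,\infty)$, $$\lim_{n\to\infty}(2n)^{\alpha}P_{2n}^{(2)}\left(\frac{x}{2n}\right)=H_\alpha(x).$$
   Context: For $n\in\mathbb{N}$, $P_{2n}^{(2)}$ denotes the unique Lagrange interpolation polynomial of degree at most $2n$ to the function $x\mapsto|x|^\alpha$ on $[-1,1]$ at the $2n+1$ nodes $x_j^{(2n+1)}=\cos\frac{(j-1/2)\pi}{2n+1}$, $j=1,\dots,2n+1$ (the zeros of the Chebyshev polynomial $T_{2n+1}$). For $\alpha>0$, $x>0$, $H(\alpha,x)=\int_0^\infty \frac{t^\alpha}{\sinh t}\frac{x\sin x}{x^2+t^2}\,dt$, and $H(\alpha,0)=0$ (its limit as $x\to 0^+$). For $x\ge0$, $H_\alpha(x)=|x|^\alpha-\frac{2}{\pi}\sin\frac{\pi\alpha}{2}\,H(\alpha,x)$. *)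

theory Defs
  imports "HOL-Analysis.Analysis" "HOL-Computational_Algebra.Polynomial"
begin

text \<open>
  The zeros of the Chebyshev polynomial of degree \<open>m\<close> (for \<open>j = 1, \<dots>, m\<close>).
\<close>
definition cheb_node :: "nat \<Rightarrow> nat \<Rightarrow> real" where
  "cheb_node m j = cos ((real j - 1 / 2) * pi / real m)"

definition is_cheb_interpolant :: "real \<Rightarrow> nat \<Rightarrow> real poly \<Rightarrow> bool" where
  "is_cheb_interpolant \<alpha> n p \<longleftrightarrow>
     degree p \<le> 2 * n \<and>
     (\<forall>j\<in>{1..2 * n + 1}.
        poly p (cheb_node (2 * n + 1) j) = \<bar>cheb_node (2 * n + 1) j\<bar> powr \<alpha>)"

text \<open>
  The polynomial \<open>P\<close> with subscript \<open>2n\<close> and superscript \<open>(2)\<close>; the description is well defined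
  by \<open>is_cheb_interpolant_ex1\<close> and \<open>is_cheb_interpolant_cheb_interp\<close> below. Note
  that \<open>0 powr \<alpha> = 0\<close>, which is the intended value of \<open>\<bar>0\<bar>\<close> to the power \<open>\<alpha>\<close>, as \<open>\<alpha> > 0\<close>.
\<close>
definition cheb_interp :: "real \<Rightarrow> nat \<Rightarrow> real poly" where
  "cheb_interp \<alpha> n = (THE p. is_cheb_interpolant \<alpha> n p)"

definition H :: "real \<Rightarrow> real \<Rightarrow> real" where
  "H \<alpha> x = (if x = 0 then 0
     else (LINT t:{0<..}|lborel. t powr \<alpha> / sinh t * (x * sin x / (x\<^sup>2 + t\<^sup>2))))"

definition H_lim :: "real \<Rightarrow> real \<Rightarrow> real" where
  "H_lim \<alpha> x = \<bar>x\<bar> powr \<alpha> - 2 / pi * sin (pi * \<alpha> / 2) * H \<alpha> x"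

lemma inj_on_cheb_node: "inj_on (cheb_node m) {1..m}"
proof (rule inj_onI)
  fix i j assume i: "i \<in> {1..m}" and j: "j \<in> {1..m}" and eq: "cheb_node m i = cheb_node m j"
  have m: "real m > 0" using i by simp
  have bounds: "0 \<le> (real k - 1 / 2) * pi / real m \<and> (real k - 1 / 2) * pi / real m \<le> pi"
    if "k \<in> {1..m}" for k
  proof -
    have "(real k - 1 / 2) * pi \<le> real m * pi"
      using that by (intro mult_right_mono) auto
    then show ?thesis using that m by (auto simp: divide_le_eq mult.commute)
  qed
  have "(real i - 1 / 2) * pi / real m = (real j - 1 / 2) * pi / real m"
    using eq bounds[OF i] bounds[OF j] unfolding cheb_node_def
    by (auto dest: cos_inj_pi)
  then show "i = j" using m by simp
qed

lemma ex_interpolating_poly: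
  fixes S :: "real set" and f :: "real \<Rightarrow> real"
  assumes "finite S"
  shows "\<exists>p. degree p \<le> card S - 1 \<and> (\<forall>x\<in>S. poly p x = f x)"
proof -
  define q where "q a = (\<Prod>b\<in>S - {a}. [:- b, 1:])" for a
  define p where "p = (\<Sum>a\<in>S. smult (f a / poly (q a) a) (q a))"
  have nz: "poly (q a) a \<noteq> 0" for a
    using assms by (auto simp: q_def poly_prod)
  have z: "poly (q a) x = 0" if "x \<in> S" "x \<noteq> a" for a x
    using assms that by (auto simp: q_def poly_prod)
  have "degree (q a) \<le> card S - 1" if "a \<in> S" for a
  proof -
    have "degree (q a) \<le> (\<Sum>b\<in>S - {a}. degree [:- b, 1:])"
      unfolding q_def using degree_prod_sum_le[of "S - {a}" "\<lambda>b. [:- b, 1:]"] assms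
      by (simp add: o_def)
    also have "\<dots> = card S - 1" using that assms by simp
    finally show ?thesis .
  qed
  then have "degree p \<le> card S - 1"
    unfolding p_def using assms
    by (intro degree_sum_le) (auto intro: order.trans[OF degree_smult_le])
  moreover have "poly p x = f x" if "x \<in> S" for x
  proof -
    have "poly p x = (\<Sum>a\<in>S. f a / poly (q a) a * poly (q a) x)"
      by (simp add: p_def poly_sum)
    also have "\<dots> = (\<Sum>a\<in>S. if a = x then f x else 0)"
      using that nz z by (intro sum.cong) auto
    also have "\<dots> = f x" using assms that by simp
    finally show ?thesis .
  qed
  ultimately show ?thesis by blast
qed

lemma is_cheb_interpolant_ex1: "\<exists>!p. is_cheb_interpolant \<alpha> n p"
proof -
  define S where "S = cheb_node (2 * n + 1) ` {1..2 * n + 1}"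
  have card: "card S = 2 * n + 1"
    unfolding S_def using card_image[OF inj_on_cheb_node[of "2 * n + 1"]] by simp
  have fin: "finite S" by (simp add: S_def)
  have iff: "is_cheb_interpolant \<alpha> n p \<longleftrightarrow>
      degree p \<le> 2 * n \<and> (\<forall>x\<in>S. poly p x = \<bar>x\<bar> powr \<alpha>)" for p
    by (auto simp: is_cheb_interpolant_def S_def)
  obtain p where p: "degree p \<le> card S - 1" "\<forall>x\<in>S. poly p x = \<bar>x\<bar> powr \<alpha>"
    using ex_interpolating_poly[OF fin, of "\<lambda>x. \<bar>x\<bar> powr \<alpha>"] by blast
  show ?thesis
  proof (rule ex1I)
    show "is_cheb_interpolant \<alpha> n p" using p card by (simp add: iff)
  next
    fix r assume r: "is_cheb_interpolant \<alpha> n r"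
    show "r = p"
    proof (rule poly_eqI_degree)
      show "poly r x = poly p x" if "x \<in> S" for x
        using r p that by (simp add: iff)
      show "card S > degree r" "card S > degree p"
        using r p card by (auto simp: iff)
    qed
  qed
qed

lemma is_cheb_interpolant_cheb_interp: "is_cheb_interpolant \<alpha> n (cheb_interp \<alpha> n)"
  unfolding cheb_interp_def by (rule theI'[OF is_cheb_interpolant_ex1])

end

theory Submission
  imports Defs "HOL-Real_Asymp.Real_Asymp"
begin

text \<open>
  Write \<open>N = 2n + 1\<close>. If \<open>\<alpha>\<close> is an even integer, the interpolant is eventually \<open>x\<^sup>\<alpha>\<close> itself and the
  sine factor vanishes. Otherwise let \<open>2m < \<alpha> < 2m + 2\<close> and represent
  \<open>|u|\<^sup>\<alpha>\<close> as \<open>(2/\<pi>) sin(\<pi>(\<alpha>-2m)/2)\<close> times the integral of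
  \<open>t\<^bsup>\<alpha>-2m-1\<^esup> u\<^bsup>2m+2\<^esup> / (u\<^sup>2 + t\<^sup>2)\<close> over \<open>t > 0\<close>. For fixed \<open>t\<close> the interpolation error of the
  rational function \<open>u\<^bsup>2m+2\<^esup> / (u\<^sup>2 + t\<^sup>2)\<close> is explicit as soon as \<open>n \<ge> m\<close>, and since interpolation
  at \<open>y\<close> is a finite linear combination of point evaluations, it commutes with the integral:
  the error \<open>|y|\<^sup>\<alpha> - P(y)\<close> equals \<open>(2/\<pi>) sin(\<pi>\<alpha>/2)\<close> times the integral of
  \<open>t\<^sup>\<alpha> / sinh(N arsinh t) \<cdot> y sin(N arcsin y) / (y\<^sup>2 + t\<^sup>2)\<close>.
  After the scaling \<open>y = x/(2n)\<close>, \<open>t = s/(2n)\<close> the integrand converges to that of \<open>H\<close>; dominated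
  convergence of the kernels \<open>s\<^sup>\<alpha> / sinh(N arsinh(s/(2n)))\<close> does not involve \<open>x\<close>, and
  \<open>|sin(N arcsin y) - sin x| \<le> \<epsilon>\<^sub>n x\<close> cancels the singularity of \<open>x / (x\<^sup>2 + s\<^sup>2)\<close> at the origin,
  so the convergence is uniform.
\<close>

subsection \<open>Polynomials for the sine of odd multiples\<close>

text \<open>
  In terms of the Chebyshev polynomials, \<open>T\<^bsub>2n+1\<^esub>(y) = (-1)\<^sup>n y V\<^sub>n(y\<^sup>2)\<close>
  with \<open>V\<^sub>n\<close> the following polynomial.
\<close>
fun odd_sine_poly :: "nat \<Rightarrow> real poly" where
  "odd_sine_poly 0 = 1"
| "odd_sine_poly (Suc 0) = [:3, -4:]"
| "odd_sine_poly (Suc (Suc n)) = [:2, -4:] * odd_sine_poly (Suc n) - odd_sine_poly n"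

lemma degree_odd_sine_poly: "degree (odd_sine_poly n) \<le> n"
proof (induction n rule: odd_sine_poly.induct)
  case (3 n)
  have "degree ([:2, -4:] * odd_sine_poly (Suc n)) \<le> degree [:2, -4::real:] + degree (odd_sine_poly (Suc n))"
    by (rule degree_mult_le)
  with 3 show ?case by (auto intro!: degree_diff_le)
qed auto

text \<open>The recursion is sin(a + 2x) + sin(a - 2x) = 2 cos(2x) sin a, where 2 cos(2x) = 2 - 4
  sin(x)^2 gives the coefficients \<open>[:2, -4:]\<close>.\<close>

lemma sin_odd_multiple:
  "sin (real (2 * n + 1) * x) = sin x * poly (odd_sine_poly n) ((sin x)\<^sup>2)"
proof (induction n rule: odd_sine_poly.induct)
  case 2
  have "sin (3 * x) = sin (2 * x + x)" by simp
  also have "\<dots> = sin x * (3 - 4 * (sin x)\<^sup>2)"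
    unfolding sin_add sin_double cos_double using sin_cos_squared_add[of x] by algebra
  finally show ?case by (simp add: algebra_simps)
next
  case (3 n)
  define a where "a = real (2 * n + 3) * x"
  have "sin (a + 2 * x) = (2 - 4 * (sin x)\<^sup>2) * sin a - sin (a - 2 * x)"
    unfolding sin_add sin_diff cos_double cos_squared_eq by (simp add: algebra_simps)
  moreover have "a + 2 * x = real (2 * Suc (Suc n) + 1) * x" "a - 2 * x = real (2 * n + 1) * x"
    "a = real (2 * Suc n + 1) * x"
    by (simp_all add: a_def algebra_simps)
  ultimately have "sin (real (2 * Suc (Suc n) + 1) * x) =
      (2 - 4 * (sin x)\<^sup>2) * sin (real (2 * Suc n + 1) * x) - sin (real (2 * n + 1) * x)"
    by metis
  then show ?case
    unfolding 3 by (simp add: algebra_simps)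
qed auto

text \<open>This is the sine formula at ix: sin^2 becomes -sinh^2. It gives access to the polynomial
  at negative arguments, in particular at -t^2, the pole of 1 / (z + t^2).\<close>

lemma sinh_odd_multiple:
  "sinh (real (2 * n + 1) * x) = sinh x * poly (odd_sine_poly n) (- (sinh x)\<^sup>2)" for x :: real
proof (induction n rule: odd_sine_poly.induct)
  case 2
  have "sinh (3 * x) = sinh (2 * x + x)" by simp
  also have "\<dots> = sinh x * (3 + 4 * (sinh x)\<^sup>2)"
    unfolding sinh_add sinh_double cosh_double using cosh_square_eq[of x] by algebra
  finally show ?case by (simp add: algebra_simps)
next
  case (3 n)
  define a where "a = real (2 * n + 3) * x"
  have "sinh (a + 2 * x) = (2 + 4 * (sinh x)\<^sup>2) * sinh a - sinh (a - 2 * x)"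
    unfolding sinh_add sinh_diff cosh_double cosh_square_eq by (simp add: algebra_simps)
  moreover have "a + 2 * x = real (2 * Suc (Suc n) + 1) * x" "a - 2 * x = real (2 * n + 1) * x"
    "a = real (2 * Suc n + 1) * x"
    by (simp_all add: a_def algebra_simps)
  ultimately have "sinh (real (2 * Suc (Suc n) + 1) * x) =
      (2 + 4 * (sinh x)\<^sup>2) * sinh (real (2 * Suc n + 1) * x) - sinh (real (2 * n + 1) * x)"
    by metis
  then show ?case
    unfolding 3 by (simp add: algebra_simps)
qed auto

section \<open>Nodes, interpolation weights and an explicit even interpolant\<close>

lemma cheb_node_root:
  assumes "u = cheb_node (2 * n + 1) j"
  shows "u * poly (odd_sine_poly n) (u\<^sup>2) = 0"
proof -
  \<comment> \<open>The complementary angle turns the cosine of the node into a sine, and 2n + 1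
    times it is a multiple of \<pi>.\<close>
  define x where "x = pi / 2 - (real j - 1 / 2) * pi / real (2 * n + 1)"
  have u: "u = sin x" by (simp add: x_def assms cheb_node_def sin_diff)
  have "real (2 * n + 1) * x = real_of_int (int n + 1 - int j) * pi"
    by (simp add: x_def field_simps)
  then have "sin (real (2 * n + 1) * x) = 0"
    by (metis sin_zero_iff_int2)
  then show ?thesis by (simp only: u sin_odd_multiple)
qed

text \<open>The weights are the values at \<open>y\<close> of the Lagrange basis polynomials. They
  serve all \<open>r\<close> at once, so interpolation at \<open>y\<close> is one fixed finite sum
  that can be exchanged with an integral over a parameter.\<close>

lemma ex_interpolation_weights:
  fixes S :: "real set"
  assumes "finite S"
  obtains w where "\<And>r. degree r < card S \<Longrightarrow> poly r y = (\<Sum>a\<in>S. w a * poly r a)"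
proof -
  have "\<exists>d. degree d \<le> card S - 1 \<and> (\<forall>x\<in>S. poly d x = of_bool (x = a))" for a
    by (rule ex_interpolating_poly[OF assms])
  then obtain d where d: "degree (d a) \<le> card S - 1" "x \<in> S \<Longrightarrow> poly (d a) x = of_bool (x = a)" for a x
    by metis
  show thesis
  proof (rule that[of "\<lambda>a. poly (d a) y"])
    fix r :: "real poly" assume r: "degree r < card S"
    define q where "q = (\<Sum>a\<in>S. smult (poly r a) (d a))"
    have "degree q \<le> card S - 1"
      unfolding q_def using assms d(1) by (intro degree_sum_le) (auto intro: order.trans[OF degree_smult_le])
    then have "r = q"
      using r assms by (intro poly_eqI_degree[of S]) (auto simp: q_def poly_sum d(2))
    then have "poly r y = poly q y" by simp
    then show "poly r y = (\<Sum>a\<in>S. poly (d a) y * poly r a)"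
      by (simp add: q_def poly_sum mult.commute)
  qed
qed

text \<open>
  Divided by \<open>z + t\<^sup>2\<close> and taken at \<open>z = u\<^sup>2\<close>, the right-hand side is
  \<open>u\<^bsup>2m+2\<^esup> / (u\<^sup>2 + t\<^sup>2)\<close> minus a term that vanishes at the nodes; the constant in front of
  that term is chosen so that \<open>z + t\<^sup>2\<close> divides the right-hand side.
\<close>
lemma ex_even_interpolant:
  assumes "t > 0" "m \<le> n"
  obtains A where "degree A \<le> n"
    "\<And>z. (z + t\<^sup>2) * poly A z =
       z ^ (m + 1) - (-1) ^ m * t ^ (2 * m) * z * poly (odd_sine_poly n) z / poly (odd_sine_poly n) (- t\<^sup>2)"
proof -
  let ?V = "odd_sine_poly n"
  have "sinh (real (2 * n + 1) * arsinh t) > 0" using assms by simp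
  then have V: "poly ?V (- t\<^sup>2) \<noteq> 0"
    using sinh_odd_multiple[of n "arsinh t"] assms by auto
  define B where "B = monom 1 (m + 1) - smult ((-1) ^ m * t ^ (2 * m) / poly ?V (- t\<^sup>2)) (pCons 0 ?V)"
  have B: "poly B z = z ^ (m + 1) - (-1) ^ m * t ^ (2 * m) * z * poly ?V z / poly ?V (- t\<^sup>2)" for z
    by (simp add: B_def poly_monom)
  have "poly B (- t\<^sup>2) = 0"
    using V by (simp add: B power_minus[of "t\<^sup>2"] power_mult)
  then have "[:t\<^sup>2, 1:] dvd B" by (simp add: poly_eq_0_iff_dvd)
  then obtain A where A: "B = [:t\<^sup>2, 1:] * A" by (elim dvdE)
  have "degree B \<le> n + 1"
    unfolding B_def using assms degree_odd_sine_poly[of n]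
    by (intro degree_diff_le order.trans[OF degree_monom_le] order.trans[OF degree_smult_le]
        order.trans[OF degree_pCons_le]) auto
  then have "degree A \<le> n"
    by (cases "A = 0") (simp_all add: A degree_mult_eq del: mult_pCons_left)
  moreover have "(z + t\<^sup>2) * poly A z = poly B z" for z
    by (simp add: A algebra_simps)
  ultimately show thesis using that B by simp
qed

subsection \<open>An integral representation of powers\<close>

lemma Beta_reflection_real:
  fixes a :: real
  shows "Beta a (1 - a) = pi / sin (pi * a)"
proof -
  have "complex_of_real (Beta a (1 - a)) = Beta (of_real a) (1 - of_real a)"
    by (simp flip: Beta_complex_of_real)
  also have "\<dots> = complex_of_real (pi / sin (pi * a))"
    by (simp add: Beta_def Gamma_reflection_complex sin_of_real flip: of_real_mult)
  finally show ?thesis by (simp only: of_real_eq_iff)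
qed

text \<open>For \<open>u\<close> nonzero, the substitution w = t^2 / (u^2 + t^2) maps the half-line
  onto (0,1) and reduces the integral to Beta(\<beta>/2, 1 - \<beta>/2), which the reflection
  formula evaluates.\<close>

lemma has_integral_powr_div_sum_squares:
  fixes u \<beta> :: real
  assumes "0 < \<beta>" "\<beta> < 2"
  shows "((\<lambda>t. t powr (\<beta> - 1) * (u\<^sup>2 / (u\<^sup>2 + t\<^sup>2))) has_integral
           \<bar>u\<bar> powr \<beta> * (pi / (2 * sin (pi * \<beta> / 2)))) {0<..}"
proof (cases "u = 0")
  case False
  define v a where "v = \<bar>u\<bar>" and "a = \<beta> / 2"
  have v: "v > 0" and u2: "u\<^sup>2 = v\<^sup>2" using False by (auto simp: v_def)
  have a: "0 < a" "a < 1" using assms by (auto simp: a_def)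
  define f where "f w = w powr (a - 1) * (1 - w) powr ((1 - a) - 1)" for w :: real
  define g where "g t = t\<^sup>2 / (v\<^sup>2 + t\<^sup>2)" for t :: real
  define g' where "g' t = 2 * t * v\<^sup>2 / (v\<^sup>2 + t\<^sup>2)\<^sup>2" for t :: real
  have pos: "v\<^sup>2 + t\<^sup>2 > 0" for t using v by (simp add: add_pos_nonneg)
  have g_less: "g t < 1" for t using v pos[of t] by (simp add: g_def field_simps)
  have one_g: "1 - g t = v\<^sup>2 / (v\<^sup>2 + t\<^sup>2)" for t using v pos[of t] by (simp add: g_def divide_simps)
  have img: "g ` {0<..} = {0<..<1}"
  proof (intro equalityI subsetI)
    fix w :: real assume w: "w \<in> {0<..<1}"
    define t where "t = v * sqrt (w / (1 - w))"
    have "t > 0" using w v by (simp add: t_def)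
    moreover have "t\<^sup>2 = v\<^sup>2 * (w / (1 - w))" using w by (simp add: t_def power_mult_distrib)
    then have "g t = w" using w v by (simp add: g_def field_simps)
    ultimately show "w \<in> g ` {0<..}" by force
  qed (use pos g_less in \<open>auto simp: g_def\<close>)
  have deriv: "(g has_field_derivative g' t) (at t within {0<..})" for t
    unfolding g_def g'_def using pos[of t]
    by (auto intro!: derivative_eq_intros simp: field_simps power2_eq_square)
  have "inj_on g {0<..}"
  proof (rule inj_onI)
    fix s t :: real assume st: "s \<in> {0<..}" "t \<in> {0<..}" "g s = g t"
    then have "v\<^sup>2 / (v\<^sup>2 + s\<^sup>2) = v\<^sup>2 / (v\<^sup>2 + t\<^sup>2)" using one_g by metis
    then have "s\<^sup>2 = t\<^sup>2" using v pos[of s] pos[of t] by (simp add: field_simps)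
    with st show "s = t" by (simp add: power2_eq_iff_nonneg)
  qed
  note subst = has_absolute_integral_change_of_variables_1'[OF _ deriv this, of f "Beta a (1 - a)"]
  have "(f has_integral Beta a (1 - a)) {0<..<1}"
    using has_integral_Beta_real[of a "1 - a"] a by (simp add: f_def[abs_def] has_integral_Icc_iff_Ioo)
  \<comment> \<open>The change of variables concerns absolute integrability, which follows here from
    nonnegativity.\<close>
  moreover from this have "f absolutely_integrable_on {0<..<1}"
    by (intro nonnegative_absolutely_integrable_1) (auto simp: f_def)
  ultimately have "((\<lambda>t. \<bar>g' t\<bar> * f (g t)) has_integral Beta a (1 - a)) {0<..}"
    using subst by (auto simp: img set_lebesgue_integral_eq_integral(1) has_integral_iff)
  \<comment> \<open>The transformed integrand is 2 v^(2-\<beta>) t^(\<beta>-1) / (v^2 + t^2), hence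
    this factor.\<close>
  from has_integral_mult_right[OF this, of "v powr \<beta> / 2"]
  have "((\<lambda>t. v powr \<beta> / 2 * (\<bar>g' t\<bar> * f (g t))) has_integral v powr \<beta> * (pi / (2 * sin (pi * \<beta> / 2)))) {0<..}"
    by (simp add: Beta_reflection_real a_def mult_ac)
  moreover have "v powr \<beta> / 2 * (\<bar>g' t\<bar> * f (g t)) = t powr (\<beta> - 1) * (u\<^sup>2 / (u\<^sup>2 + t\<^sup>2))" if "t \<in> {0<..}" for t
  proof -
    have t: "t > 0" using that by simp
    define D where "D = v\<^sup>2 + t\<^sup>2"
    have D: "D > 0" using pos by (simp add: D_def)
    have "f (g t) = (t\<^sup>2 / D) powr (a - 1) * (v\<^sup>2 / D) powr (- a)"
      unfolding f_def one_g by (simp add: g_def D_def)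
    also have "\<dots> = t powr (\<beta> - 2) * v powr (- \<beta>) * (D powr (1 - a) * D powr a)"
    proof -
      have "(t\<^sup>2) powr (a - 1) = t powr (\<beta> - 2)" "(v\<^sup>2) powr (- a) = v powr (- \<beta>)"
        using t v by (simp_all add: powr_powr a_def algebra_simps flip: powr_numeral)
      moreover have "D powr (1 - a) = inverse (D powr (a - 1))" "D powr a = inverse (D powr (- a))"
        by (simp_all flip: powr_minus)
      ultimately show ?thesis using t v D by (simp add: powr_divide) (simp add: divide_inverse mult_ac)
    qed
    also have "D powr (1 - a) * D powr a = D" using D by (simp flip: powr_add)
    finally have f_g: "f (g t) = t powr (\<beta> - 2) * v powr (- \<beta>) * D" .
    have t_powr: "t powr (\<beta> - 1) = t * t powr (\<beta> - 2)"
      using t powr_add[of t 1 "\<beta> - 2"] by simp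
    have abs_g': "\<bar>g' t\<bar> = 2 * t * v\<^sup>2 / D\<^sup>2"
      using t by (simp add: g'_def D_def)
    have "v powr \<beta> / 2 * (\<bar>g' t\<bar> * f (g t)) =
        (v powr \<beta> * v powr (- \<beta>)) * (t powr (\<beta> - 1) * (v\<^sup>2 / D))"
      unfolding f_g abs_g' t_powr using D by (simp add: power2_eq_square)
    also have "v powr \<beta> * v powr (- \<beta>) = 1" using v by (simp flip: powr_add)
    finally show ?thesis by (simp only: D_def u2 mult_1)
  qed
  ultimately show ?thesis unfolding v_def[symmetric]
    by (rule has_integral_eq[rotated])
qed (use assms in auto)

subsection \<open>The interpolation error\<close>

text \<open>The denominator is the modulus of the Chebyshev polynomial of degree 2n + 1 at the
  imaginary point is/(2n), for s \<ge> 0.\<close>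

definition scaled_kernel :: "real \<Rightarrow> nat \<Rightarrow> real \<Rightarrow> real" where
  "scaled_kernel \<alpha> n s = s powr \<alpha> / sinh (real (2 * n + 1) * arsinh (s / (2 * real n)))"

text \<open>Only exponents in (0,2) are covered by the previous representation. It is applied to
  \<alpha> - 2m, and the factor u^(2m) restores the exponent \<alpha>.\<close>

lemma has_integral_powr_interpolation:
  fixes u \<alpha> :: real
  assumes "2 * real m < \<alpha>" "\<alpha> < 2 * real m + 2"
  shows "((\<lambda>s. s powr (\<alpha> - 2 * m - 1) * (u ^ (2 * m + 2) / (u\<^sup>2 + s\<^sup>2))) has_integral
           \<bar>u\<bar> powr \<alpha> * (pi / (2 * sin (pi * (\<alpha> - 2 * m) / 2)))) {0<..}"
proof -
  have "\<bar>u\<bar> powr (\<alpha> - 2 * m) * u ^ (2 * m) = \<bar>u\<bar> powr \<alpha>"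
  proof (cases "u = 0")
    case False
    then have "u ^ (2 * m) = \<bar>u\<bar> powr (2 * m)"
      using powr_realpow[of "\<bar>u\<bar>" "2 * m"] by (simp add: power_even_abs)
    then show ?thesis by (simp flip: powr_add)
  qed (use assms in auto)
  with has_integral_mult_left[OF has_integral_powr_div_sum_squares[of "\<alpha> - 2 * m" u], of "u ^ (2 * m)"] assms
  show ?thesis
    by (simp add: power_add power2_eq_square mult_ac)
qed

text \<open>Dividing the identity for \<open>A\<close> by y^2 + t^2 leaves a quotient of values of
  \<open>odd_sine_poly\<close>, at y^2 and -t^2. Absorbing one factor y and one factor t turns these
  values into the sine and the hyperbolic sine. The sine vanishes at the nodes, so A(u^2)
  interpolates there.\<close>

lemma even_interpolation_error:
  assumes "t > 0" "\<bar>y\<bar> \<le> 1"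
    and A: "\<And>z. (z + t\<^sup>2) * poly A z =
       z ^ (m + 1) - (-1) ^ m * t ^ (2 * m) * z * poly (odd_sine_poly n) z / poly (odd_sine_poly n) (- t\<^sup>2)"
  shows "y ^ (2 * m + 2) / (y\<^sup>2 + t\<^sup>2) - poly A (y\<^sup>2) =
    (-1) ^ m * t ^ (2 * m + 1) / sinh (real (2 * n + 1) * arsinh t) *
     (y * sin (real (2 * n + 1) * arcsin y) / (y\<^sup>2 + t\<^sup>2))"
proof -
  have V: "t * poly (odd_sine_poly n) (- t\<^sup>2) = sinh (real (2 * n + 1) * arsinh t)"
    by (simp only: sinh_odd_multiple sinh_arsinh_real)
  moreover have "sinh (real (2 * n + 1) * arsinh t) > 0" using assms by simp
  ultimately have V0: "poly (odd_sine_poly n) (- t\<^sup>2) \<noteq> 0" by auto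
  have W: "sin (real (2 * n + 1) * arcsin y) = y * poly (odd_sine_poly n) (y\<^sup>2)"
    using assms by (simp only: sin_odd_multiple) (simp add: abs_le_iff)
  have eq: "y ^ (2 * m + 2) - (y\<^sup>2 + t\<^sup>2) * poly A (y\<^sup>2) = 
     (-1) ^ m * t ^ (2 * m) * y\<^sup>2 * poly (odd_sine_poly n) (y\<^sup>2) / poly (odd_sine_poly n) (- t\<^sup>2)"
    unfolding A using power_mult[of y 2 "m + 1"] by (simp add: mult.commute)
  have "y ^ (2 * m + 2) / (y\<^sup>2 + t\<^sup>2) - poly A (y\<^sup>2) =
      (y ^ (2 * m + 2) - (y\<^sup>2 + t\<^sup>2) * poly A (y\<^sup>2)) / (y\<^sup>2 + t\<^sup>2)"
    using assms(1) by (simp add: diff_divide_distrib)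
  then show ?thesis
    unfolding eq W V[symmetric] using V0 assms(1) by (simp add: power2_eq_square)
qed

lemma cheb_interp_error_non_even:
  fixes \<alpha> x :: real
  assumes \<alpha>: "2 * real m < \<alpha>" "\<alpha> < 2 * real m + 2" and n: "m \<le> n" "n > 0" and x: "0 \<le> x" "x \<le> 2 * real n"
  shows "((\<lambda>s. scaled_kernel \<alpha> n s * (x * sin (real (2 * n + 1) * arcsin (x / (2 * real n))) / (x\<^sup>2 + s\<^sup>2)))
     has_integral
       (x powr \<alpha> - (2 * real n) powr \<alpha> * poly (cheb_interp \<alpha> n) (x / (2 * real n))) *
       (pi / (2 * sin (pi * \<alpha> / 2)))) {0<..}"
proof -
  define M where "M = 2 * real n"
  define N where "N = 2 * n + 1"
  define S where "S = cheb_node N ` {1..N}"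
  define y where "y = x / M"
  have M: "M > 0" using n by (simp add: M_def)
  have y: "\<bar>y\<bar> \<le> 1" and xy: "x = M * y" using x M by (auto simp: y_def M_def)
  have "finite S" and card: "card S = 2 * n + 1"
    unfolding S_def N_def using card_image[OF inj_on_cheb_node[of "2 * n + 1"]] by simp_all
  then obtain w where w: "\<And>r. degree r \<le> 2 * n \<Longrightarrow> poly r y = (\<Sum>a\<in>S. w a * poly r a)"
    using ex_interpolation_weights[of S y] by (metis less_Suc_eq_le Suc_eq_plus1)
  have interp: "degree (cheb_interp \<alpha> n) \<le> 2 * n"
     "\<And>a. a \<in> S \<Longrightarrow> poly (cheb_interp \<alpha> n) a = \<bar>a\<bar> powr \<alpha>"
    using is_cheb_interpolant_cheb_interp[of \<alpha> n] by (auto simp: is_cheb_interpolant_def S_def N_def)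
  have S_le: "\<bar>a\<bar> \<le> 1" and S_root: "sin (real (2 * n + 1) * arcsin a) = 0" if "a \<in> S" for a
  proof -
    show "\<bar>a\<bar> \<le> 1" using that by (auto simp: S_def cheb_node_def)
    then show "sin (real (2 * n + 1) * arcsin a) = 0"
      using cheb_node_root[of a n] that unfolding S_def N_def
      by (simp only: sin_odd_multiple) (auto simp add: abs_le_iff)
  qed
  define F where "F s u = u ^ (2 * m + 2) / (u\<^sup>2 + s\<^sup>2)" for s u :: real
  define c where "c = pi / (2 * sin (pi * (\<alpha> - 2 * m) / 2))"
  have rep: "((\<lambda>s. s powr (\<alpha> - 2 * m - 1) * F s u) has_integral \<bar>u\<bar> powr \<alpha> * c) {0<..}" for u
    unfolding F_def c_def by (rule has_integral_powr_interpolation[OF \<alpha>])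
  have "((\<lambda>s. s powr (\<alpha> - 2 * m - 1) * F s x - (\<Sum>a\<in>S. w a * (s powr (\<alpha> - 2 * m - 1) * F s (M * a))))
      has_integral \<bar>x\<bar> powr \<alpha> * c - (\<Sum>a\<in>S. w a * (\<bar>M * a\<bar> powr \<alpha> * c))) {0<..}"
    by (intro has_integral_diff rep has_integral_sum has_integral_mult_right \<open>finite S\<close>)
  \<comment> \<open>The weights reproduce the interpolant at \<open>y\<close> from its nodal values
    |a|^\<alpha>; the scaling contributes M^\<alpha>.\<close>
  also have "(\<Sum>a\<in>S. w a * (\<bar>M * a\<bar> powr \<alpha> * c)) = M powr \<alpha> * poly (cheb_interp \<alpha> n) y * c"
    using M by (simp add: w[OF interp(1)] interp(2) abs_mult powr_mult sum_distrib_left sum_distrib_right mult_ac)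
  also have "\<bar>x\<bar> powr \<alpha> * c - \<dots> = (x powr \<alpha> - M powr \<alpha> * poly (cheb_interp \<alpha> n) y) * c"
    using x by (simp add: algebra_simps)
  finally have int: "((\<lambda>s. s powr (\<alpha> - 2 * m - 1) * (F s x - (\<Sum>a\<in>S. w a * F s (M * a)))) has_integral
      (x powr \<alpha> - M powr \<alpha> * poly (cheb_interp \<alpha> n) y) * c) {0<..}"
    by (simp add: algebra_simps sum_distrib_left sum_distrib_right)
  have "s powr (\<alpha> - 2 * m - 1) * (F s x - (\<Sum>a\<in>S. w a * F s (M * a))) =
     (-1) ^ m * (scaled_kernel \<alpha> n s * (x * sin (real N * arcsin y) / (x\<^sup>2 + s\<^sup>2)))" if "s \<in> {0<..}" for s
  proof -
    define t where "t = s / M"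
    have t: "t > 0" and st: "s = M * t" using that M by (auto simp: t_def)
    obtain A where A: "degree A \<le> n"
      "\<And>z. (z + t\<^sup>2) * poly A z =
       z ^ (m + 1) - (-1) ^ m * t ^ (2 * m) * z * poly (odd_sine_poly n) z / poly (odd_sine_poly n) (- t\<^sup>2)"
      using ex_even_interpolant[OF t n(1)] by blast
    note err = even_interpolation_error[OF t _ A(2)]
    \<comment> \<open>\<open>F\<close> is homogeneous of degree 2m in its two arguments
      jointly.\<close>
    have scale: "F s (M * u) = M ^ (2 * m) * F t u" for u
      using M by (simp add: F_def st power_mult_distrib power_add power2_eq_square divide_simps
          flip: distrib_left) (simp add: algebra_simps power2_eq_square power_mult_distrib)
    have deg: "degree (A \<circ>\<^sub>p [:0, 0, 1:]) \<le> 2 * n"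
      using A(1) by (simp add: degree_pcompose)
    \<comment> \<open>A(u^2) agrees with \<open>F t\<close> at the nodes and has degree at most 2n,
      so the same weights give its value at \<open>y\<close>.\<close>
    have "(\<Sum>a\<in>S. w a * F t a) = (\<Sum>a\<in>S. w a * poly (A \<circ>\<^sub>p [:0, 0, 1:]) a)"
      using err[OF S_le] S_root by (intro sum.cong) (auto simp: F_def poly_pcompose power2_eq_square)
    also have "\<dots> = poly A (y\<^sup>2)"
      using w[OF deg] by (simp add: poly_pcompose power2_eq_square)
    finally have sum: "(\<Sum>a\<in>S. w a * F t a) = poly A (y\<^sup>2)" .
    have "F s x - (\<Sum>a\<in>S. w a * F s (M * a)) = M ^ (2 * m) * (F t y - (\<Sum>a\<in>S. w a * F t a))"
      unfolding xy scale by (simp add: algebra_simps sum_distrib_left)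
    also have "F t y - (\<Sum>a\<in>S. w a * F t a) = 
      (-1) ^ m * t ^ (2 * m + 1) / sinh (real N * arsinh t) *
       (y * sin (real N * arcsin y) / (y\<^sup>2 + t\<^sup>2))"
      unfolding sum using err[OF y] by (simp add: F_def N_def)
    also have "y * sin (real N * arcsin y) / (y\<^sup>2 + t\<^sup>2) = M * (x * sin (real N * arcsin y) / (x\<^sup>2 + s\<^sup>2))"
    proof -
      have "x\<^sup>2 + s\<^sup>2 = M\<^sup>2 * (y\<^sup>2 + t\<^sup>2)"
        by (simp add: xy st power_mult_distrib distrib_left)
      then show ?thesis using M by (simp add: xy power2_eq_square)
    qed
    also have "M ^ (2 * m) * ((-1) ^ m * t ^ (2 * m + 1) / sinh (real N * arsinh t) * 
        (M * (x * sin (real N * arcsin y) / (x\<^sup>2 + s\<^sup>2)))) = 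
       s ^ (2 * m + 1) * ((-1) ^ m / sinh (real N * arsinh t) * (x * sin (real N * arcsin y) / (x\<^sup>2 + s\<^sup>2)))"
      by (simp add: st power_mult_distrib mult_ac)
    also have "s powr (\<alpha> - 2 * m - 1) * \<dots> = (-1) ^ m * (s powr (\<alpha> - 2 * m - 1) * s ^ (2 * m + 1) /
         sinh (real N * arsinh t) * (x * sin (real N * arcsin y) / (x\<^sup>2 + s\<^sup>2)))"
      by simp
    also have "s powr (\<alpha> - 2 * m - 1) * s ^ (2 * m + 1) = s powr \<alpha>"
      using that powr_realpow[of s "2 * m + 1"] powr_add[of s "\<alpha> - 2 * m - 1" "1 + 2 * real m"]
      by (simp del: power_Suc)
    finally show ?thesis by (simp add: scaled_kernel_def t_def N_def M_def)
  qed
  with int have "((\<lambda>s. (-1) ^ m * (scaled_kernel \<alpha> n s * (x * sin (real N * arcsin y) / (x\<^sup>2 + s\<^sup>2))))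
      has_integral (x powr \<alpha> - M powr \<alpha> * poly (cheb_interp \<alpha> n) y) * c) {0<..}"
    by (rule has_integral_eq[rotated])
  from has_integral_mult_right[OF this, of "(-1) ^ m"]
  have "((\<lambda>s. scaled_kernel \<alpha> n s * (x * sin (real N * arcsin y) / (x\<^sup>2 + s\<^sup>2)))
      has_integral (-1) ^ m * ((x powr \<alpha> - M powr \<alpha> * poly (cheb_interp \<alpha> n) y) * c)) {0<..}"
    by (simp flip: mult.assoc power_add add: mult_2[symmetric])
  \<comment> \<open>Shifting the angle by m\<pi> produces the sign (-1)^m, which cancels the one
    from the pointwise error.\<close>
  moreover have "pi * (\<alpha> - 2 * m) / 2 = pi * \<alpha> / 2 - m * pi"
    by (simp add: right_diff_distrib diff_divide_distrib mult.commute)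
  then have "sin (pi * (\<alpha> - 2 * m) / 2) = (-1) ^ m * sin (pi * \<alpha> / 2)"
    by (simp only: sin_diff cos_npi sin_npi mult.commute) simp
  then have "(-1) ^ m * c = pi / (2 * sin (pi * \<alpha> / 2))"
    by (cases "even m") (simp_all add: c_def)
  then have "(-1) ^ m * ((x powr \<alpha> - M powr \<alpha> * poly (cheb_interp \<alpha> n) y) * c) = 
     (x powr \<alpha> - M powr \<alpha> * poly (cheb_interp \<alpha> n) y) * (pi / (2 * sin (pi * \<alpha> / 2)))"
    by (simp only: mult.left_commute[of "(-1) ^ m"])
  ultimately show ?thesis by (simp add: N_def y_def M_def)
qed

text \<open>The case m = 0 is excluded because 0 is a node and \<open>0 powr 0 = 0\<close>.\<close>

lemma cheb_interp_even_power:
  assumes "m \<le> n" "m > 0"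
  shows "cheb_interp (2 * real m) n = monom 1 (2 * m)"
proof -
  have "\<bar>a\<bar> powr (2 * real m) = a ^ (2 * m)" for a :: real
    using powr_realpow[of "\<bar>a\<bar>" "2 * m"] assms(2) by (cases "a = 0") (simp_all add: power_even_abs)
  then have "is_cheb_interpolant (2 * real m) n (monom 1 (2 * m))"
    using assms by (auto simp: is_cheb_interpolant_def poly_monom intro: order.trans[OF degree_monom_le])
  then show ?thesis
    using is_cheb_interpolant_ex1 is_cheb_interpolant_cheb_interp by blast
qed

text \<open>With the sine on the right, the formula also covers even integers \<alpha>, where both
  sides vanish. The limit argument then needs no case distinction.\<close>

lemma cheb_interp_error:
  fixes \<alpha> x :: real
  assumes "\<alpha> > 0" "\<alpha> \<le> 2 * real n" "0 \<le> x" "x \<le> 2 * real n"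
  shows "x powr \<alpha> - (2 * real n) powr \<alpha> * poly (cheb_interp \<alpha> n) (x / (2 * real n)) =
     2 / pi * sin (pi * \<alpha> / 2) * integral {0<..}
       (\<lambda>s. scaled_kernel \<alpha> n s * (x * sin (real (2 * n + 1) * arcsin (x / (2 * real n))) / (x\<^sup>2 + s\<^sup>2)))"
proof -
  have n: "n > 0" using assms by (cases n) auto
  define m where "m = nat \<lfloor>\<alpha> / 2\<rfloor>"
  have m: "2 * real m \<le> \<alpha>" "\<alpha> < 2 * real m + 2" using assms by (auto simp: m_def) linarith+
  have mn: "m \<le> n" using m(1) assms by linarith
  show ?thesis
  proof (cases "\<alpha> = 2 * real m")
    case True
    then have "m > 0" using assms by (cases m) auto
    have "x powr \<alpha> = x ^ (2 * m)" 
      using powr_realpow[of x "2 * m"] assms True \<open>m > 0\<close> by (cases "x = 0") simp_all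
    moreover have "(2 * real n) powr \<alpha> = (2 * real n) ^ (2 * m)"
      using powr_realpow[of "2 * real n" "2 * m"] True n by simp
    moreover have "sin (pi * \<alpha> / 2) = 0" using True by (simp add: mult.commute)
    ultimately show ?thesis
      using n unfolding True cheb_interp_even_power[OF mn \<open>m > 0\<close>]
      by (simp add: poly_monom power_divide)
  next
    case False
    then have m': "2 * real m < \<alpha>" using m by simp
    have "sin (pi * \<alpha> / 2) \<noteq> 0"
    proof
      assume "sin (pi * \<alpha> / 2) = 0"
      then obtain i :: int where "pi * \<alpha> / 2 = of_int i * pi" by (auto simp: sin_zero_iff_int2)
      then have i: "\<alpha> = 2 * of_int i" by simp
      with m' m(2) have "int m < i" "i < int m + 1" by linarith+
      then show False by simp
    qed
    then show ?thesis
      using integral_unique[OF cheb_interp_error_non_even[OF m' m(2) mn n assms(3,4)]] by simp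
  qed
qed

subsection \<open>Convergence of the kernels\<close>

lemma arsinh_real_nonneg_iff: "0 \<le> arsinh x \<longleftrightarrow> 0 \<le> (x :: real)"
  using arsinh_real_neg_iff[of x] by linarith

lemma sinh_multiple_ge:
  fixes x :: real
  assumes "x \<ge> 0"
  shows "real n * sinh x \<le> sinh (real n * x)"
proof (induction n)
  case (Suc n)
  have "sinh (real n * x) * 1 \<le> sinh (real n * x) * cosh x" "1 * sinh x \<le> cosh (real n * x) * sinh x"
    using assms by (intro mult_left_mono mult_right_mono cosh_real_ge_1; simp)+
  moreover have "sinh (real (Suc n) * x) = sinh (real n * x) * cosh x + cosh (real n * x) * sinh x"
    by (simp add: algebra_simps sinh_add)
  ultimately show ?case using Suc by (simp add: algebra_simps)
qed auto

text \<open>Since exp(arsinh t) = t + sqrt(t^2 + 1) \<ge> 1 + t, the right-hand side is at least (1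
  + s/n)^n. Its k-th binomial term is at least (n/k)^k (s/n)^k = (s/k)^k, a bound free of n.\<close>

lemma power_le_exp_multiple_arsinh:
  assumes "k \<le> n" "0 < k" "0 \<le> s"
  shows "(s / real k) ^ k \<le> exp (real (n + 1) * arsinh (s / real n))"
proof -
  have n: "n > 0" using assms by simp
  have "(s / real k) ^ k = (real n / real k) ^ k * (s / n) ^ k"
    using n by (simp flip: power_mult_distrib)
  also have "\<dots> \<le> real (n choose k) * (s / n) ^ k"
    using assms by (intro mult_right_mono binomial_ge_n_over_k_pow_k) auto
  also have "\<dots> \<le> (\<Sum>i\<le>n. real (n choose i) * (s / n) ^ i)"
    using assms by (intro member_le_sum[of k "{..n}"]) auto
  also have "\<dots> = (s / n + 1) ^ n"
    by (simp add: binomial_ring)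
  also have "\<dots> \<le> (s / n + 1) ^ (n + 1)"
    using assms by (intro power_increasing) auto
  also have "\<dots> \<le> exp (arsinh (s / n)) ^ (n + 1)"
    using assms arsinh_real_aux[of "s / n"]
    by (intro power_mono) (auto simp: arsinh_real_def)
  finally show ?thesis by (simp only: exp_of_nat_mult)
qed

text \<open>A majorant independent of \<open>n\<close>: the first branch is integrable at 0 for
  \<alpha> > 0, the second at infinity for k > \<alpha> + 1. Beyond 2k the power (s/k)^k is at least
  2, which leaves room for the term exp(-E) of sinh.\<close>

definition kernel_bound :: "real \<Rightarrow> nat \<Rightarrow> real \<Rightarrow> real" where
  "kernel_bound \<alpha> k s =
     (if s \<le> 2 * real k then s powr (\<alpha> - 1) else 4 * real k ^ k * s powr (\<alpha> - real k))"

lemma scaled_kernel_nonneg: "s \<ge> 0 \<Longrightarrow> scaled_kernel \<alpha> n s \<ge> 0"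
  by (simp add: scaled_kernel_def arsinh_real_nonneg_iff)

lemma scaled_kernel_le_bound:
  assumes "0 < k" "k \<le> 2 * n" "0 < s"
  shows "scaled_kernel \<alpha> n s \<le> kernel_bound \<alpha> k s"
proof -
  let ?D = "sinh (real (2 * n + 1) * arsinh (s / (2 * real n)))"
  have n: "n > 0" using assms by simp
  show ?thesis
  proof (cases "s \<le> 2 * real k")
    case True
    have "s \<le> real (2 * n + 1) * (s / (2 * real n))" using n assms by (simp add: field_simps)
    also have "\<dots> \<le> ?D"
      using sinh_multiple_ge[of "arsinh (s / (2 * real n))" "2 * n + 1"] assms by (simp add: arsinh_real_nonneg_iff)
    finally have "s powr \<alpha> / ?D \<le> s powr \<alpha> / s" 
      using assms by (intro divide_left_mono mult_pos_pos) auto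
    then show ?thesis using True assms by (simp add: scaled_kernel_def kernel_bound_def powr_diff)
  next
    case False
    define q where "q = (s / real k) ^ k"
    have "2 \<le> s / real k" using False assms by (simp add: field_simps)
    then have "2 ^ 1 \<le> (s / real k) ^ k"
      using assms by (intro order.trans[OF power_increasing power_mono]) auto
    then have q: "q \<ge> 2" by (simp add: q_def)
    define E where "E = real (2 * n + 1) * arsinh (s / (2 * real n))"
    have "q \<le> exp E"
      using power_le_exp_multiple_arsinh[of k "2 * n" s] assms by (simp add: q_def E_def)
    moreover have "exp (- E) \<le> 1"
      using assms by (simp add: E_def arsinh_real_nonneg_iff)
    \<comment> \<open>With q \<ge> 2, (q - 1)/2 \<ge> q/4; this is the source of the factor 4 in
      \<open>kernel_bound\<close>.\<close>
    ultimately have "(q - 1) / 2 \<le> (exp E - exp (- E)) / 2"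
      by (intro divide_right_mono diff_mono) auto
    moreover have "q / 4 \<le> (q - 1) / 2" using q by simp
    ultimately have "q / 4 \<le> (exp E - exp (- E)) / 2" by (rule order.trans[rotated])
    then have q_le: "q / 4 \<le> ?D"
      by (simp only: E_def sinh_field_def)
    moreover have pos: "0 < q / 4" using q by simp
    ultimately have "0 < ?D" by (rule less_le_trans[rotated])
    then have "s powr \<alpha> / ?D \<le> s powr \<alpha> / (q / 4)"
      by (intro divide_left_mono mult_pos_pos pos q_le) auto
    also have "\<dots> = 4 * real k ^ k * s powr (\<alpha> - real k)"
      using assms by (simp add: q_def powr_diff powr_realpow power_divide)
    finally show ?thesis using False by (simp add: scaled_kernel_def kernel_bound_def)
  qed
qed

lemma kernel_bound_integrable:
  assumes "\<alpha> > 0" "\<alpha> + 1 < real k"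
  shows "kernel_bound \<alpha> k integrable_on {0<..}"
proof -
  have k: "k > 0" using assms by simp
  have "(\<lambda>s. s powr (\<alpha> - 1)) integrable_on {0..2 * real k}"
    using assms by (intro integrable_on_powr_from_0) auto
  then have "kernel_bound \<alpha> k integrable_on {0..2 * real k}"
    by (rule integrable_eq) (simp add: kernel_bound_def)
  moreover have "(\<lambda>s. s powr (\<alpha> - real k)) integrable_on {2 * real k..}"
    using has_integral_powr_to_inf[of "\<alpha> - real k" "2 * real k"] assms k by (auto simp: integrable_on_def)
  then have "(\<lambda>s. 4 * real k ^ k * s powr (\<alpha> - real k)) integrable_on {2 * real k..}"
    by (rule integrable_on_mult_right)
  then have "kernel_bound \<alpha> k integrable_on {2 * real k..}"
    by (rule integrable_spike[of _ _ "{2 * real k}"]) (auto simp: kernel_bound_def)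
  moreover have "negligible ({0..2 * real k} \<inter> {2 * real k..})"
    by (rule negligible_subset[of "{2 * real k}"]) auto
  ultimately have "kernel_bound \<alpha> k integrable_on ({0..2 * real k} \<union> {2 * real k..})"
    by (intro integrable_Un)
  also have "{0..2 * real k} \<union> {2 * real k..} = {0..}" by auto
  finally show ?thesis
    by (rule integrable_spike_set) (auto intro: negligible_subset[of "{0}"])
qed

lemma scaled_kernel_tendsto:
  assumes "s > 0"
  shows "(\<lambda>n. scaled_kernel \<alpha> n s) \<longlonglongrightarrow> s powr \<alpha> / sinh s"
proof -
  have "(\<lambda>n. real (2 * n + 1) * arsinh (s / (2 * real n))) \<longlonglongrightarrow> s"
    unfolding arsinh_real_def using assms by real_asymp
  then show ?thesis
    unfolding scaled_kernel_def using assms by (intro tendsto_intros) auto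
qed

lemma continuous_on_scaled_kernel:
  "n > 0 \<Longrightarrow> continuous_on {0<..} (scaled_kernel \<alpha> n)"
  unfolding scaled_kernel_def[abs_def]
  by (intro continuous_intros) auto

section \<open>Integrability against x c / (x^2 + s^2) and convergence of the kernels in
  mean\<close>

lemma bounded_continuous_imp_absolutely_integrable_on:
  fixes f g :: "real \<Rightarrow> real"
  assumes "continuous_on {0<..} f" "g integrable_on {0<..}" "\<And>s. s > 0 \<Longrightarrow> \<bar>f s\<bar> \<le> g s"
  shows "f absolutely_integrable_on {0<..}"
  using assms
  by (intro measurable_bounded_by_integrable_imp_absolutely_integrable[of f "{0<..}" g]
      continuous_imp_measurable_on_sets_lebesgue) auto

text \<open>A factor \<open>c\<close> of size O(x) makes the numerator O(x^2), so the bound is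
  uniform in \<open>s\<close> and \<open>x\<close> up to the origin.\<close>

lemma abs_mult_divide_sum_squares_le:
  fixes x c d s :: real
  assumes "0 \<le> x" "0 \<le> d" "\<bar>c\<bar> \<le> x * d"
  shows "\<bar>x * c / (x\<^sup>2 + s\<^sup>2)\<bar> \<le> d"
proof (cases "x = 0")
  case False
  have "\<bar>x * c\<bar> \<le> d * x\<^sup>2"
    using mult_left_mono[OF assms(3,1)] assms(1) by (simp add: abs_mult power2_eq_square mult_ac)
  also have "\<dots> \<le> d * (x\<^sup>2 + s\<^sup>2)" using assms(2) by (intro mult_left_mono) auto
  finally show ?thesis using False by (simp add: divide_le_eq sum_power2_gt_zero_iff)
qed (use assms in simp)

lemma kernel_absolutely_integrable:
  fixes G B :: "real \<Rightarrow> real" and x c d :: real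
  assumes G: "continuous_on {0<..} G" "\<And>s. s > 0 \<Longrightarrow> 0 \<le> G s" "\<And>s. s > 0 \<Longrightarrow> G s \<le> B s"
    and "B integrable_on {0<..}" and c: "0 \<le> x" "0 \<le> d" "\<bar>c\<bar> \<le> x * d"
  shows "(\<lambda>s. G s * (x * c / (x\<^sup>2 + s\<^sup>2))) absolutely_integrable_on {0<..}"
proof (rule bounded_continuous_imp_absolutely_integrable_on)
  show "continuous_on {0<..} (\<lambda>s. G s * (x * c / (x\<^sup>2 + s\<^sup>2)))"
    by (intro continuous_intros G) (auto simp: sum_power2_eq_zero_iff)
  show "(\<lambda>s. B s * d) integrable_on {0<..}"
    by (rule integrable_on_mult_left) fact
  show "\<bar>G s * (x * c / (x\<^sup>2 + s\<^sup>2))\<bar> \<le> B s * d" if "s > 0" for s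
    unfolding abs_mult using G(2,3)[OF that] abs_mult_divide_sum_squares_le[OF c, of s]
    by (intro mult_mono) auto
qed

lemma sinh_kernel_le_bound:
  assumes "0 < k" "0 < s"
  shows "s powr \<alpha> / sinh s \<le> kernel_bound \<alpha> k s"
  using assms
  by (intro tendsto_upperbound[OF scaled_kernel_tendsto] eventually_sequentiallyI[of k] scaled_kernel_le_bound) auto

lemma H_eq_integral:
  assumes "\<alpha> > 0" "x \<ge> 0"
  shows "H \<alpha> x = integral {0<..} (\<lambda>s. s powr \<alpha> / sinh s * (x * sin x / (x\<^sup>2 + s\<^sup>2)))"
proof (cases "x = 0")
  case False
  \<comment> \<open>This makes the tail exponent \<alpha> - k of the majorant smaller than
    -1.\<close>
  define k where "k = nat \<lceil>\<alpha>\<rceil> + 2"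
  have k: "\<alpha> + 1 < real k" "k > 0" using assms by (auto simp: k_def) linarith
  let ?f = "\<lambda>s. s powr \<alpha> / sinh s * (x * sin x / (x\<^sup>2 + s\<^sup>2))"
  have "?f absolutely_integrable_on {0<..}"
    using sinh_kernel_le_bound[OF k(2)] abs_sin_x_le_abs_x[of x] assms
    by (intro kernel_absolutely_integrable[OF _ _ _ kernel_bound_integrable[OF assms(1) k(1)], of _ _ 1]
        continuous_intros) auto
  moreover have c: "continuous_on {0<..} ?f"
    using False by (intro continuous_intros) auto
  \<comment> \<open>\<open>H\<close> integrates over \<open>lborel\<close>, absolute integrability
    refers to its completion; Borel measurability bridges the two.\<close>
  then have "(\<lambda>s. indicator {0<..} s *\<^sub>R ?f s) \<in> borel_measurable lborel"
    using borel_measurable_continuous_on_indicator[OF _ c] by simp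
  ultimately have "set_integrable lborel {0<..} ?f"
    unfolding set_integrable_def by (simp only: integrable_completion)
  then show ?thesis
    using False by (simp add: H_def set_borel_integral_eq_integral(2))
qed (simp add: H_def)

lemma integral_kernel_diff_tendsto_0:
  assumes "\<alpha> > 0"
  shows "(\<lambda>n. integral {0<..} (\<lambda>s. \<bar>scaled_kernel \<alpha> n s - s powr \<alpha> / sinh s\<bar>)) \<longlonglongrightarrow> 0"
    (is "(\<lambda>n. integral _ (?f n)) \<longlonglongrightarrow> 0")
proof -
  define k where "k = nat \<lceil>\<alpha>\<rceil> + 2"
  have k: "\<alpha> + 1 < real k" "k > 0" using assms by (auto simp: k_def) linarith
  have g: "(\<lambda>s. 2 * kernel_bound \<alpha> k s) integrable_on {0<..}"
    using kernel_bound_integrable[OF assms k(1)] by (rule integrable_on_mult_right)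
  have bound: "\<bar>?f n s\<bar> \<le> 2 * kernel_bound \<alpha> k s" if "n \<ge> k" "s > 0" for n s
  proof -
    have abs_diff_le: "\<bar>u - v\<bar> \<le> 2 * b" if "0 \<le> u" "u \<le> b" "0 \<le> v" "v \<le> b" for u v b :: real
      using that by arith
    show ?thesis
      unfolding abs_idempotent using that k
      by (intro abs_diff_le scaled_kernel_le_bound sinh_kernel_le_bound scaled_kernel_nonneg) auto
  qed
  have cont: "continuous_on {0<..} (?f n)" if "n > 0" for n
    by (intro continuous_intros continuous_on_scaled_kernel that) auto
  \<comment> \<open>The majorant is available for n \<ge> k, so the sequence is shifted by
    \<open>k\<close>.\<close>
  have "(\<lambda>n. integral {0<..} (?f (n + k))) \<longlonglongrightarrow> integral {0<..} (\<lambda>_ :: real. 0)"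
  proof (rule dominated_convergence(2)[OF _ g])
    show "?f (n + k) integrable_on {0<..}" for n
      using bound k by (intro set_lebesgue_integral_eq_integral(1)
          bounded_continuous_imp_absolutely_integrable_on[OF cont g]) auto
    show "norm (?f (n + k) s) \<le> 2 * kernel_bound \<alpha> k s" if "s \<in> {0<..}" for n s
      using bound[of "n + k" s] that by simp
    show "(\<lambda>n. ?f (n + k) s) \<longlonglongrightarrow> 0" if "s \<in> {0<..}" for s
    proof (rule LIMSEQ_ignore_initial_segment)
      show "(\<lambda>n. ?f n s) \<longlonglongrightarrow> 0"
        using tendsto_rabs[OF LIM_zero[OF scaled_kernel_tendsto[of s \<alpha>]]] that by simp
    qed
  qed
  then have "(\<lambda>n. integral {0<..} (?f (n + k))) \<longlonglongrightarrow> 0" by simp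
  then show ?thesis by (rule LIMSEQ_offset[of "\<lambda>n. integral {0<..} (?f n)"])
qed

section \<open>Comparison of sin((2n+1) arcsin(x/(2n))) with sin x\<close>

lemma arcsin_bounds:
  assumes "0 \<le> y" "y < 1"
  shows "y \<le> arcsin y" "arcsin y \<le> y / sqrt (1 - y\<^sup>2)"
proof -
  have "0 \<le> arcsin y" using assms arcsin_le_arcsin[of 0 y] by simp
  then show "y \<le> arcsin y" using sin_x_le_x[of "arcsin y"] assms by simp
  have "0 \<le> y / sqrt (1 - y\<^sup>2)" using assms by (simp add: abs_square_le_1)
  then show "arcsin y \<le> y / sqrt (1 - y\<^sup>2)"
    using assms arctan_le_self[of "y / sqrt (1 - y\<^sup>2)"] by (simp add: arcsin_arctan)
qed

lemma abs_sin_diff_le: "\<bar>sin a - sin b\<bar> \<le> \<bar>a - b\<bar>" for a b :: real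
proof -
  have "\<bar>sin a - sin b\<bar> = 2 * (\<bar>sin ((a - b) / 2)\<bar> * \<bar>cos ((a + b) / 2)\<bar>)"
    by (simp add: sin_diff_sin abs_mult)
  also have "\<dots> \<le> 2 * (\<bar>(a - b) / 2\<bar> * 1)"
    by (intro mult_left_mono mult_mono abs_sin_x_le_abs_x) auto
  finally show ?thesis by simp
qed

text \<open>By the bounds on arcsin, the argument of the first sine lies between x and x r, where r
  - 1 is the factor on the right; the sine is 1-Lipschitz. The error must be relative to x for
  \<open>abs_mult_divide_sum_squares_le\<close> to apply.\<close>

lemma sin_multiple_arcsin_diff_le:
  assumes "0 \<le> x" "x \<le> a" "a < 2 * real n"
  shows "\<bar>sin (real (2 * n + 1) * arcsin (x / (2 * real n))) - sin x\<bar> \<le>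
     x * ((1 + 1 / (2 * real n)) / sqrt (1 - (a / (2 * real n))\<^sup>2) - 1)"
proof -
  define M where "M = 2 * real n"
  define y where "y = x / M"
  have M: "M > 0" "a < M" using assms by (auto simp: M_def)
  have y: "0 \<le> y" "y < 1" using assms M by (auto simp: y_def)
  have x: "x = M * y" using M by (simp add: y_def)
  have "y \<le> a / M" using assms M by (simp add: y_def divide_right_mono)
  then have "y\<^sup>2 \<le> (a / M)\<^sup>2" using y by (intro power_mono)
  moreover have "(a / M)\<^sup>2 < 1" using assms M by (simp add: abs_square_less_1)
  ultimately have "y / sqrt (1 - y\<^sup>2) \<le> y / sqrt (1 - (a / M)\<^sup>2)"
    using y by (intro divide_left_mono) auto
  with arcsin_bounds[OF y] have up: "arcsin y \<le> y / sqrt (1 - (a / M)\<^sup>2)" by linarith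
  define r where "r = (1 + 1 / M) / sqrt (1 - (a / M)\<^sup>2)"
  have "(M + 1) * arcsin y \<le> (M + 1) * (y / sqrt (1 - (a / M)\<^sup>2))"
    using up M by (intro mult_left_mono) auto
  also have "\<dots> = x * r"
  proof -
    have "M + 1 = M * (1 + 1 / M)" using M by (simp add: field_simps)
    then show ?thesis by (simp only: x r_def times_divide_eq_right mult_ac)
  qed
  finally have "(M + 1) * arcsin y \<le> x * r" .
  moreover have "x \<le> (M + 1) * arcsin y"
    unfolding x using arcsin_bounds(1)[OF y] y M by (intro mult_mono) auto
  ultimately have "\<bar>(M + 1) * arcsin y - x\<bar> \<le> x * (r - 1)"
    by (simp add: right_diff_distrib)
  with abs_sin_diff_le[of "(M + 1) * arcsin y" x]
  have "\<bar>sin ((M + 1) * arcsin y) - sin x\<bar> \<le> x * (r - 1)"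
    by linarith
  moreover have "real (2 * n + 1) = M + 1" by (simp add: M_def)
  ultimately show ?thesis by (simp only: y_def r_def M_def)
qed

section \<open>Uniform convergence\<close>

lemma kernel_integral_diff_le:
  fixes \<alpha> x :: real
  assumes \<alpha>: "\<alpha> > 0" "\<alpha> + 1 < real k" and k: "0 < k" "k \<le> n" and x: "0 \<le> x" "x \<le> a" "a < 2 * real n"
  defines "\<epsilon> \<equiv> (1 + 1 / (2 * real n)) / sqrt (1 - (a / (2 * real n))\<^sup>2) - 1"
  defines "N \<equiv> real (2 * n + 1)" and "y \<equiv> x / (2 * real n)"
  shows "\<bar>integral {0<..} (\<lambda>s. scaled_kernel \<alpha> n s * (x * sin (N * arcsin y) / (x\<^sup>2 + s\<^sup>2))) -
      integral {0<..} (\<lambda>s. s powr \<alpha> / sinh s * (x * sin x / (x\<^sup>2 + s\<^sup>2)))\<bar>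
    \<le> integral {0<..} (\<lambda>s. \<bar>scaled_kernel \<alpha> n s - s powr \<alpha> / sinh s\<bar>) + \<epsilon> * integral {0<..} (kernel_bound \<alpha> k)"
    (is "\<bar>integral _ ?f - integral _ ?g\<bar> \<le> integral _ ?h + _")
proof -
  let ?B = "kernel_bound \<alpha> k"
  have n: "n > 0" using k by simp
  have B: "?B integrable_on {0<..}" by (rule kernel_bound_integrable[OF \<alpha>])
  have "(a / (2 * real n))\<^sup>2 < 1" using x by (simp add: abs_square_less_1)
  then have "1 * sqrt (1 - (a / (2 * real n))\<^sup>2) \<le> 1 + 1 / (2 * real n)"
    using real_sqrt_le_1_iff[of "1 - (a / (2 * real n))\<^sup>2"] by (simp add: add_increasing2)
  with \<open>(a / (2 * real n))\<^sup>2 < 1\<close> have \<epsilon>: "\<epsilon> \<ge> 0"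
    unfolding \<epsilon>_def by (subst diff_ge_0_iff_ge, subst pos_le_divide_eq) auto
  have sin_diff: "\<bar>sin (N * arcsin y) - sin x\<bar> \<le> x * \<epsilon>"
    using sin_multiple_arcsin_diff_le[OF x] by (simp only: \<epsilon>_def N_def y_def)
  have sin_x: "\<bar>sin x\<bar> \<le> x * 1" using abs_sin_x_le_abs_x[of x] x by simp
  have sin_N: "\<bar>sin (N * arcsin y)\<bar> \<le> x * (1 + \<epsilon>)"
    using sin_diff sin_x by (simp add: distrib_left)
  have Gn: "0 \<le> scaled_kernel \<alpha> n s" "scaled_kernel \<alpha> n s \<le> ?B s" if "s > 0" for s
    using scaled_kernel_nonneg[of s \<alpha> n] scaled_kernel_le_bound[of k n s \<alpha>] that k by auto
  have G: "0 \<le> s powr \<alpha> / sinh s" "s powr \<alpha> / sinh s \<le> ?B s" if "s > 0" for s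
    using sinh_kernel_le_bound[of k s \<alpha>] that k by auto
  have f: "?f integrable_on {0<..}"
    using Gn n x \<epsilon> sin_N
    by (intro set_lebesgue_integral_eq_integral(1) kernel_absolutely_integrable[OF _ _ _ B, of _ _ "1 + \<epsilon>"]
        continuous_on_scaled_kernel) auto
  have g: "?g integrable_on {0<..}"
    using G x sin_x
    by (intro set_lebesgue_integral_eq_integral(1) kernel_absolutely_integrable[OF _ _ _ B, of _ _ 1]
        continuous_intros) auto
  have h: "?h integrable_on {0<..}"
  proof (intro set_lebesgue_integral_eq_integral(1) bounded_continuous_imp_absolutely_integrable_on[OF _ B])
    show "continuous_on {0<..} ?h"
      by (intro continuous_intros continuous_on_scaled_kernel n) auto
    show "\<bar>?h s\<bar> \<le> ?B s" if "s > 0" for s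
      using Gn[OF that] G[OF that] by simp
  qed
  have "norm (integral {0<..} (\<lambda>s. ?f s - ?g s)) \<le> integral {0<..} (\<lambda>s. ?h s + \<epsilon> * ?B s)"
  proof (rule integral_norm_bound_integral)
    show "(\<lambda>s. ?f s - ?g s) integrable_on {0<..}" by (intro integrable_diff f g)
    show "(\<lambda>s. ?h s + \<epsilon> * ?B s) integrable_on {0<..}"
      by (intro integrable_add h integrable_on_mult_right B)
    fix s :: real assume "s \<in> {0<..}"
    then have s: "s > 0" by simp
    let ?q = "\<lambda>c. x * c / (x\<^sup>2 + s\<^sup>2)" and ?\<delta> = "sin (N * arcsin y) - sin x"
    \<comment> \<open>The change of kernel is paired with sin x, the change of sine with the scaled
      kernel; each quotient is bounded independently of \<open>s\<close> and
      \<open>x\<close>.\<close>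
    have "?f s - ?g s = (scaled_kernel \<alpha> n s - s powr \<alpha> / sinh s) * ?q (sin x) + scaled_kernel \<alpha> n s * ?q ?\<delta>"
      by (simp add: left_diff_distrib right_diff_distrib diff_divide_distrib)
    also have "norm \<dots> \<le> ?h s * \<bar>?q (sin x)\<bar> + \<bar>scaled_kernel \<alpha> n s\<bar> * \<bar>?q ?\<delta>\<bar>"
      unfolding real_norm_def abs_mult[symmetric] by (rule abs_triangle_ineq)
    also have "\<dots> \<le> ?h s * 1 + ?B s * \<epsilon>"
      using Gn[OF s] abs_mult_divide_sum_squares_le[OF x(1) _ sin_x, of s]
        abs_mult_divide_sum_squares_le[OF x(1) \<epsilon> sin_diff, of s]
      by (intro add_mono mult_mono) auto
    finally show "norm (?f s - ?g s) \<le> ?h s + \<epsilon> * ?B s" by (simp add: mult.commute)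
  qed
  also have "integral {0<..} (\<lambda>s. ?f s - ?g s) = integral {0<..} ?f - integral {0<..} ?g"
    by (intro integral_diff f g)
  also have "integral {0<..} (\<lambda>s. ?h s + \<epsilon> * ?B s) = integral {0<..} ?h + \<epsilon> * integral {0<..} ?B"
    using h B by (subst integral_add) (auto intro: integrable_on_mult_right)
  finally show ?thesis by simp
qed

theorem theorem3p2:
  fixes \<alpha> :: real
  assumes "\<alpha> > 0"
  shows "\<forall>K. compact K \<and> K \<subseteq> {0..} \<longrightarrow>
    uniform_limit K
      (\<lambda>n x. (2 * real n) powr \<alpha> * poly (cheb_interp \<alpha> n) (x / (2 * real n)))
      (H_lim \<alpha>) sequentially"
proof (intro allI impI)
  fix K :: "real set" assume K: "compact K \<and> K \<subseteq> {0..}"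
  obtain a where a: "\<And>x. x \<in> K \<Longrightarrow> x \<le> a"
    using K compact_imp_bounded[of K] by (auto simp: bounded_real) (metis abs_le_D1)
  define k where "k = nat \<lceil>\<alpha>\<rceil> + 2"
  have k: "\<alpha> + 1 < real k" "k > 0" using assms by (auto simp: k_def) linarith
  define \<epsilon> where "\<epsilon> n = (1 + 1 / (2 * real n)) / sqrt (1 - (a / (2 * real n))\<^sup>2) - 1" for n
  \<comment> \<open>\<open>E\<close> bounds the difference of the integrals for all x in
    \<open>K\<close> at once.\<close>
  define E where "E n = integral {0<..} (\<lambda>s. \<bar>scaled_kernel \<alpha> n s - s powr \<alpha> / sinh s\<bar>) +
     \<epsilon> n * integral {0<..} (kernel_bound \<alpha> k)" for n
  have inv: "(\<lambda>n. 1 / (2 * real n)) \<longlonglongrightarrow> 0" by real_asymp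
  have "(\<lambda>n. (1 + 1 / (2 * real n)) / sqrt (1 - (a * (1 / (2 * real n)))\<^sup>2) - 1) \<longlonglongrightarrow>
      (1 + 0) / sqrt (1 - (a * 0)\<^sup>2) - 1"
    by (intro tendsto_intros inv) auto
  then have "\<epsilon> \<longlonglongrightarrow> 0" by (simp add: \<epsilon>_def[abs_def])
  then have "E \<longlonglongrightarrow> 0 + 0 * integral {0<..} (kernel_bound \<alpha> k)"
    unfolding E_def by (intro tendsto_intros integral_kernel_diff_tendsto_0 assms)
  then have lim: "(\<lambda>n. \<bar>2 / pi * sin (pi * \<alpha> / 2)\<bar> * E n) \<longlonglongrightarrow> 0"
    by (intro tendsto_mult_right_zero) simp
  show "uniform_limit K (\<lambda>n x. (2 * real n) powr \<alpha> * poly (cheb_interp \<alpha> n) (x / (2 * real n)))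
      (H_lim \<alpha>) sequentially"
  proof (rule uniform_limitI)
    fix e :: real assume "e > 0"
    then have "\<forall>\<^sub>F n in sequentially. \<bar>2 / pi * sin (pi * \<alpha> / 2)\<bar> * E n < e"
      using lim by (rule order_tendstoD(2)[rotated])
    moreover have "\<forall>\<^sub>F n in sequentially. n \<ge> k" by (rule eventually_ge_at_top)
    moreover have "\<forall>\<^sub>F n in sequentially. a < 2 * real n" by real_asymp
    ultimately show "\<forall>\<^sub>F n in sequentially. \<forall>x\<in>K.
        dist ((2 * real n) powr \<alpha> * poly (cheb_interp \<alpha> n) (x / (2 * real n))) (H_lim \<alpha> x) < e"
    proof eventually_elim
      case (elim n)
      show ?case
      proof
        fix x assume x: "x \<in> K"
        then have x: "0 \<le> x" "x \<le> a" using K a by auto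
        have *: "dist p (h - c * I') = \<bar>c\<bar> * \<bar>I - I'\<bar>" if "h - p = c * I" for p h c I I' :: real
        proof -
          have "p - (h - c * I') = - (c * (I - I'))" using that by (simp add: algebra_simps)
          then show ?thesis by (simp add: dist_real_def abs_mult)
        qed
        \<comment> \<open>n \<ge> k > \<alpha> + 1 and 2n > a bring \<alpha> and x into the range of
          the error formula.\<close>
        have "\<alpha> \<le> 2 * real n" "x \<le> 2 * real n" using k elim x by linarith+
        then have "dist ((2 * real n) powr \<alpha> * poly (cheb_interp \<alpha> n) (x / (2 * real n))) (H_lim \<alpha> x) =
            \<bar>2 / pi * sin (pi * \<alpha> / 2)\<bar> *
            \<bar>integral {0<..} (\<lambda>s. scaled_kernel \<alpha> n s *
                (x * sin (real (2 * n + 1) * arcsin (x / (2 * real n))) / (x\<^sup>2 + s\<^sup>2))) -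
              integral {0<..} (\<lambda>s. s powr \<alpha> / sinh s * (x * sin x / (x\<^sup>2 + s\<^sup>2)))\<bar>"
          unfolding H_lim_def H_eq_integral[OF assms x(1)] abs_of_nonneg[OF x(1)]
          by (intro * cheb_interp_error assms x(1))
        also have "\<dots> \<le> \<bar>2 / pi * sin (pi * \<alpha> / 2)\<bar> * E n"
          unfolding E_def \<epsilon>_def using k elim(2)
          by (intro mult_left_mono kernel_integral_diff_le assms x elim(3)) auto
        also have "\<dots> < e" by (rule elim(1))
        finally show "dist ((2 * real n) powr \<alpha> * poly (cheb_interp \<alpha> n) (x / (2 * real n))) (H_lim \<alpha> x) < e" .
      qed
    qed
  qed
qed

end
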